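(* Let $A,B$ and $S$ be non-empty subsets of a finite Abelian group $G$. Assume that $|A|+|B|=|G|+L_S$, where $L_S=|S|\,L(G)$, and that $|A\wedge^S B|=|G|-2|S|$. Then (i) there exists a subgroup $H$ of $2\cdot G$ such that $S$ is a coset modulo $H$, and (ii) $G\setminus(A\wedge^S B)$ is a union of two cosets modulo $H$.
   Context: Groups are written additively. For subsets $A,B,S$ of a finite Abelian group $G$: $A\wedge^S B=\{a+b:\ a\in A,\ b\in B,\ a-b\notin S\}$. For $z\in G$, $L_S(z)=|\{(x,y)\in G\times G:\ x+y=z,\ x-y\in S\}|$, and $L_S=\max_{z\in G}L_S(z)$. $L(G)=|\{x\in G:2x=0\}|$ and $2\cdot G=\{2x:x\in G\}$. *)

theory Defs
  imports "HOL-Algebra.Coset"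
begin

text \<open>HOL-Algebra groups are written multiplicatively: below, \<open>x \<otimes> y\<close> stands for \<open>x + y\<close>,
  \<open>x \<otimes> inv y\<close> for \<open>x - y\<close>, \<open>\<one>\<close> for \<open>0\<close> and \<open>x \<otimes> x\<close> for \<open>2x\<close>.\<close>

definition restricted_sumset :: "('a, 'b) monoid_scheme \<Rightarrow> 'a set \<Rightarrow> 'a set \<Rightarrow> 'a set \<Rightarrow> 'a set" where
  "restricted_sumset G S A B =
     {a \<otimes>\<^bsub>G\<^esub> b | a b. a \<in> A \<and> b \<in> B \<and> a \<otimes>\<^bsub>G\<^esub> inv\<^bsub>G\<^esub> b \<notin> S}"

definition L_at :: "('a, 'b) monoid_scheme \<Rightarrow> 'a set \<Rightarrow> 'a \<Rightarrow> nat" where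
  "L_at G S z = card {(x, y) \<in> carrier G \<times> carrier G.
     x \<otimes>\<^bsub>G\<^esub> y = z \<and> x \<otimes>\<^bsub>G\<^esub> inv\<^bsub>G\<^esub> y \<in> S}"

definition L_max :: "('a, 'b) monoid_scheme \<Rightarrow> 'a set \<Rightarrow> nat" where
  "L_max G S = Max (L_at G S ` carrier G)"

definition L_group :: "('a, 'b) monoid_scheme \<Rightarrow> nat" where
  "L_group G = card {x \<in> carrier G. x \<otimes>\<^bsub>G\<^esub> x = \<one>\<^bsub>G\<^esub>}"

definition doubles :: "('a, 'b) monoid_scheme \<Rightarrow> 'a set" where
  "doubles G = {x \<otimes>\<^bsub>G\<^esub> x | x. x \<in> carrier G}"

end

theory Submission
  imports Defs "HOL-Algebra.Generated_Groups"
begin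

text \<open>Write the group additively and let \<open>Z\<close> be the set of elements missed by the restricted
  sumset, so \<open>|Z| = 2|S|\<close>. Counting representations of \<open>z \<in> Z\<close> shows that \<open>z + S \<subseteq> 2 \<cdot> G\<close> and that
  \<open>A\<close> is the disjoint union of \<open>{x. 2x \<in> z + S}\<close> and \<open>z - (G - B)\<close>. With
  \<open>F = {u. all halves of u lie in A}\<close> and \<open>E = {v. no half of -v lies in B}\<close>, inside \<open>2 \<cdot> G\<close> the set
  \<open>F\<close> is the disjoint union of \<open>z + S\<close> and \<open>2z + E\<close>, for every \<open>z \<in> Z\<close>.

  Comparing three elements of \<open>Z\<close> gives functions on the integer lattice, whose rigidity shows: for
  \<open>t \<in> S\<close>, among any three elements of \<open>Z\<close> there are two, \<open>z\<close> and \<open>w\<close>, with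
  \<open>t + z - w\<close> and \<open>t + w - z\<close> in \<open>S\<close>. This relation on the \<open>2|S|\<close> points of \<open>Z\<close> has closed
  neighbourhoods of size at most \<open>|S|\<close> and no three pairwise unrelated points, so it consists of two
  cliques of size \<open>|S|\<close>; hence \<open>S - t\<close> is a subgroup and the cliques are its cosets.\<close>

section \<open>Rigidity of simultaneous tilings of the integer lattice\<close>

lemma int_shift_invariant:
  fixes g :: "int \<Rightarrow> 'c"
  assumes "\<And>i. g (i + 1) = g i"
  shows "g i = g j"
proof -
  have "g k = g 0" for k
  proof (induction k rule: int_induct[where k = 0])
    case (step2 i)
    then show ?case using assms[of "i - 1"] by simp
  qed (auto simp: assms)
  then show ?thesis by metis
qed

text \<open>Models three elements \<open>z1\<close>, \<open>z2\<close>, \<open>z3\<close> of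
  \<open>Z\<close> at once, \<open>s\<close> being the indicator of \<open>S\<close> at
  \<open>t + i(z2 - z1) + j(z3 - z1)\<close>. Replacing \<open>z1\<close> by another element moves
  the argument of \<open>s\<close> by one lattice step and that of \<open>f\<close> by two, since
  \<open>z\<close> enters \<open>S\<close> once and \<open>F\<close> doubled.\<close>

locale lattice_tiling =
  fixes e f s :: "int \<Rightarrow> int \<Rightarrow> int"
  assumes e01: "e i j = 0 \<or> e i j = 1"
    and f01: "f i j = 0 \<or> f i j = 1"
    and s_nonneg: "0 \<le> s i j"
    and tile0: "f i j = s i j + e i j"
    and tile1: "f (i + 2) j = s (i + 1) j + e i j"
    and tile2: "f i (j + 2) = s i (j + 1) + e i j"
    and origin: "s 0 0 = 1"
begin

text \<open>Conserved quantities: eliminating \<open>s\<close> between two of the three tile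
  equations leaves a sum of one \<open>e\<close> and one \<open>f\<close> that is constant along a
  line. The cells chosen here are just representatives on that line.\<close>

definition row :: "int \<Rightarrow> int" where "row j = e 0 j + f 1 j"
definition col :: "int \<Rightarrow> int" where "col i = e i 0 + f i 1"
definition diag :: "int \<Rightarrow> int" where "diag k = e k 0 + f (k + 1) 1"

lemma row_eq: "e i j + f (i + 1) j = row j"
proof -
  have "e (i + 1) j + f (i + 1 + 1) j = e i j + f (i + 1) j" for i
    using tile0[of "i + 1" j] tile1[of i j] by (simp add: algebra_simps)
  from int_shift_invariant[of "\<lambda>i. e i j + f (i + 1) j", OF this, of i 0]
  show ?thesis by (simp add: row_def)
qed

lemma col_eq: "e i j + f i (j + 1) = col i"
proof -
  have "e i (j + 1) + f i (j + 1 + 1) = e i j + f i (j + 1)" for j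
    using tile0[of i "j + 1"] tile2[of i j] by (simp add: algebra_simps)
  from int_shift_invariant[of "\<lambda>j. e i j + f i (j + 1)", OF this, of j 0]
  show ?thesis by (simp add: col_def)
qed

text \<open>Here \<open>s\<close> is eliminated between \<open>tile1\<close> and
  \<open>tile2\<close>, so the invariant direction is \<open>(1, -1)\<close>; on antidiagonal
  \<open>k\<close> the cells of \<open>e\<close> satisfy \<open>i + j = k\<close> and those of
  \<open>f\<close> satisfy \<open>i + j = k + 2\<close>.\<close>

lemma diag_eq: "e i j + f (i + 1) (j + 1) = diag (i + j)"
proof -
  have "e (k - (j + 1)) (j + 1) + f (k - (j + 1) + 1) (j + 1 + 1) =
      e (k - j) j + f (k - j + 1) (j + 1)" for k j
    using tile1[of "k - j - 1" "j + 1"] tile2[of "k - j" j] by (simp add: algebra_simps)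
  from int_shift_invariant[of "\<lambda>t. e (i + j - t) t + f (i + j - t + 1) (t + 1)", OF this, of j 0]
  show ?thesis by (simp add: diag_def)
qed

lemma row_range: "row j = 0 \<or> row j = 1 \<or> row j = 2"
  using e01[of 0 j] f01[of 1 j] unfolding row_def by auto

lemma col_range: "col i = 0 \<or> col i = 1 \<or> col i = 2"
  using e01[of i 0] f01[of i 1] unfolding col_def by auto

lemma diag_range: "diag k = 0 \<or> diag k = 1 \<or> diag k = 2"
  using e01[of k 0] f01[of "k + 1" 1] unfolding diag_def by auto

lemma row_2D: "row j = 2 \<Longrightarrow> e i j = 1 \<and> f i j = 1"
  using row_eq[of i j] row_eq[of "i - 1" j] e01[of i j] e01[of "i - 1" j] f01[of i j]
    f01[of "i + 1" j] by auto

lemma row_0D: "row j = 0 \<Longrightarrow> e i j = 0"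
  using row_eq[of i j] e01[of i j] f01[of "i + 1" j] by auto

lemma col_2D: "col i = 2 \<Longrightarrow> e i j = 1 \<and> f i j = 1"
  using col_eq[of i j] col_eq[of i "j - 1"] e01[of i j] e01[of i "j - 1"] f01[of i j]
    f01[of i "j + 1"] by auto

lemma col_0D: "col i = 0 \<Longrightarrow> e i j = 0"
  using col_eq[of i j] e01[of i j] f01[of i "j + 1"] by auto

lemma diag_2D: "diag (i + j) = 2 \<Longrightarrow> e i j = 1 \<and> f (i + 1) (j + 1) = 1"
  using diag_eq[of i j] e01[of i j] f01[of "i + 1" "j + 1"] by auto

lemma diag_0D: "diag (i + j) = 0 \<Longrightarrow> e i j = 0"
  using diag_eq[of i j] e01[of i j] f01[of "i + 1" "j + 1"] by auto

text \<open>Each tile equation in which \<open>s 0 0 = 1\<close> occurs forces its \<open>f\<close>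
  to be 1 and its \<open>e\<close> to be 0. This fixes the three lines associated with the origin at
  the middle value 1.\<close>

lemma origin_values: "e 0 0 = 0" "e (-1) 0 = 0" "row 0 = 1" "col 0 = 1" "diag (-1) = 1"
proof -
  show e0: "e 0 0 = 0" using tile0[of 0 0] origin e01[of 0 0] f01[of 0 0] by auto
  have f1: "f 1 0 = 1" "e (-1) 0 = 0"
    using tile1[of "-1" 0] origin e01[of "-1" 0] f01[of 1 0] by auto
  have f2: "f 0 1 = 1"
    using tile2[of 0 "-1"] origin e01[of 0 "-1"] f01[of 0 1] by auto
  show "e (-1) 0 = 0" by fact
  show "row 0 = 1" "col 0 = 1" "diag (-1) = 1"
    using e0 f1 f2 by (simp_all add: row_def col_def diag_def)
qed

text \<open>Row \<open>j\<close>, column \<open>i\<close> and antidiagonal \<open>i + j - 1\<close>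
  are concurrent: if two of them have value 2, they supply the \<open>e\<close> and the
  \<open>f\<close> of a defining pair of the third.\<close>

lemma row_2_of: "col i = 2 \<Longrightarrow> diag k = 2 \<Longrightarrow> row (k - i + 1) = 2"
  using row_eq[of "i - 1" "k - i + 1"] col_2D[of i "k - i + 1"] diag_2D[of "i - 1" "k - i + 1"]
  by simp

lemma col_2_of: "row j = 2 \<Longrightarrow> diag k = 2 \<Longrightarrow> col (k - j + 1) = 2"
  using col_eq[of "k - j + 1" "j - 1"] row_2D[of j "k - j + 1"] diag_2D[of "k - j + 1" "j - 1"]
  by simp

lemma diag_2_of: "row j = 2 \<Longrightarrow> col i = 2 \<Longrightarrow> diag (i + j - 1) = 2"
  using diag_eq[of i "j - 1"] row_2D[of j "i + 1"] col_2D[of i "j - 1"]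
  by (simp add: algebra_simps)

lemma row_2_minus_2:
  assumes "row j = 2" "col i = 2"
  shows "row (j - 2) = 2"
proof (rule ccontr)
  assume "row (j - 2) \<noteq> 2"
  moreover have "e i (j - 2) = 1" using assms(2) col_2D by blast
  ultimately have "row (j - 2) = 1" using row_range[of "j - 2"] row_0D by force
  then have "f (i + 1) (j - 2) = 0" using row_eq[of i "j - 2"] \<open>e i (j - 2) = 1\<close> by simp
  \<comment> \<open>The antidiagonal \<open>i + j - 1\<close>, forced to value 2 by the given row
    and column, passes through this cell; \<open>tile0\<close> makes \<open>f \<ge> e\<close>
    there.\<close>
  moreover have "e (i + 1) (j - 2) = 1"
    using diag_2_of[OF assms] diag_2D[of "i + 1" "j - 2"] by simp
  ultimately show False using tile0[of "i + 1" "j - 2"] s_nonneg[of "i + 1" "j - 2"] by simp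
qed

text \<open>If a row and a column carried the value 2, then all odd rows and columns would, and
  hence the antidiagonal through \<open>(-1, 0)\<close> as well.\<close>

lemma not_row_col_2: "\<not> (row j = 2 \<and> col i = 2)"
proof
  assume A: "row j = 2 \<and> col i = 2"
  have step: "row (j - 2) = 2 \<and> row (j + 2) = 2 \<and> col (i - 2) = 2 \<and> col (i + 2) = 2"
    if "row j = 2" "col i = 2" for i j
  proof -
    note r = row_2_minus_2[OF that]
    \<comment> \<open>Only the downward row move needed an argument; the other three moves follow by
      concurrency with antidiagonals \<open>i + j - 3\<close> and \<open>i + j - 1\<close>.\<close>
    have c1: "col (i - 2) = 2" using col_2_of[OF that(1) diag_2_of[OF r that(2)]] by simp
    have c2: "col (i + 2) = 2" using col_2_of[OF r diag_2_of[OF that]] by (simp add: algebra_simps)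
    have "row (j + 2) = 2" using row_2_of[OF c1 diag_2_of[OF that]] by (simp add: algebra_simps)
    with r c1 c2 show ?thesis by blast
  qed
  have all: "row (j + 2 * n) = 2 \<and> col (i + 2 * m) = 2" for n m
  proof -
    have "row (j + 2 * n) = 2 \<and> col i = 2" for n
    proof (induction n rule: int_induct[where k = 0])
      case base then show ?case using A by simp
    next
      case (step1 n)
      then show ?case using step[of "j + 2 * n" i] by (simp add: algebra_simps)
    next
      case (step2 n)
      then show ?case using step[of "j + 2 * n" i] by (simp add: algebra_simps)
    qed
    moreover have "col (i + 2 * m) = 2 \<and> row j = 2" for m
    proof (induction m rule: int_induct[where k = 0])
      case base then show ?case using A by simp
    next
      case (step1 n)
      then show ?case using step[of j "i + 2 * n"] by (simp add: algebra_simps)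
    next
      case (step2 n)
      then show ?case using step[of j "i + 2 * n"] by (simp add: algebra_simps)
    qed
    ultimately show ?thesis by blast
  qed
  have "odd j" using all[of "- (j div 2)" 0] origin_values(3) by (auto elim!: evenE)
  moreover have "odd i" using all[of 0 "- (i div 2)"] origin_values(4) by (auto elim!: evenE)
  ultimately have "row 1 = 2" "col (-1) = 2"
    using all[of "- (j div 2)" "- (i div 2) - 1"] by (auto elim!: oddE simp: algebra_simps)
  then show False using diag_2_of[of 1 "-1"] origin_values(5) by simp
qed

lemma not_two_2:
  "\<not> (row j = 2 \<and> col i = 2)" "\<not> (row j = 2 \<and> diag k = 2)" "\<not> (col i = 2 \<and> diag k = 2)"
  using not_row_col_2 col_2_of row_2_of by blast+

text \<open>Complementing values and reflecting through the origin exchanges \<open>e\<close> with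
  \<open>f\<close>, and line value 2 with 0. Statements about the value 0 thus follow from those
  about 2.\<close>

lemma reflected: "lattice_tiling (\<lambda>i j. 1 - f (-i) (-j)) (\<lambda>i j. 1 - e (-i) (-j)) (\<lambda>i j. s (-i) (-j))"
proof
  fix i j
  show "1 - e (-i) (-j) = s (-i) (-j) + (1 - f (-i) (-j))" using tile0[of "-i" "-j"] by simp
  show "1 - e (- (i + 2)) (-j) = s (- (i + 1)) (-j) + (1 - f (-i) (-j))"
    using tile1[of "-i - 2" "-j"] by (simp add: algebra_simps)
  show "1 - e (-i) (- (j + 2)) = s (-i) (- (j + 1)) + (1 - f (-i) (-j))"
    using tile2[of "-i" "-j - 2"] by (simp add: algebra_simps)
  show "1 - f (-i) (-j) = 0 \<or> 1 - f (-i) (-j) = 1" using f01[of "-i" "-j"] by auto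
  show "1 - e (-i) (-j) = 0 \<or> 1 - e (-i) (-j) = 1" using e01[of "-i" "-j"] by auto
qed (auto simp: s_nonneg origin)

lemma not_two_0:
  "\<not> (row j = 0 \<and> col i = 0)" "\<not> (row j = 0 \<and> diag k = 0)" "\<not> (col i = 0 \<and> diag k = 0)"
proof -
  interpret R: lattice_tiling "\<lambda>i j. 1 - f (-i) (-j)" "\<lambda>i j. 1 - e (-i) (-j)" "\<lambda>i j. s (-i) (-j)"
    by (rule reflected)
  have "R.row (-j) = 2 - row j" for j
    using row_eq[of "-1" j] by (simp add: R.row_def)
  moreover have "R.col (-i) = 2 - col i" for i
    using col_eq[of i "-1"] by (simp add: R.col_def)
  \<comment> \<open>The offset 2 arises because \<open>e\<close> and \<open>f\<close> live on
    antidiagonals \<open>k\<close> and \<open>k + 2\<close>, and the reflection swaps their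
    roles.\<close>
  moreover have "R.diag (-k - 2) = 2 - diag k" for k
    using diag_eq[of "k + 1" "-1"] by (simp add: R.diag_def algebra_simps)
  ultimately show
    "\<not> (row j = 0 \<and> col i = 0)" "\<not> (row j = 0 \<and> diag k = 0)" "\<not> (col i = 0 \<and> diag k = 0)"
    using R.not_two_2(1)[of "-j" "-i"] R.not_two_2(2)[of "-j" "-k - 2"]
      R.not_two_2(3)[of "-i" "-k - 2"] by auto
qed

text \<open>Equal extreme values are already excluded. A 0 and a 2 would clash at the cell where the
  two lines cross, as \<open>e\<close> would be both 0 and 1 there.\<close>

lemma at_most_one_direction:
  "row j = 1 \<or> col i = 1" "row j = 1 \<or> diag k = 1" "col i = 1 \<or> diag k = 1"
proof -
  show "row j = 1 \<or> col i = 1"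
    using not_two_0(1)[of j i] not_two_2(1)[of j i] row_range[of j] col_range[of i]
      row_2D[of j i] row_0D[of j i] col_2D[of i j] col_0D[of i j] by auto
  show "row j = 1 \<or> diag k = 1"
    using not_two_0(2)[of j k] not_two_2(2)[of j k] row_range[of j] diag_range[of k]
      row_2D[of j "k - j"] row_0D[of j "k - j"] diag_2D[of "k - j" j] diag_0D[of "k - j" j] by auto
  show "col i = 1 \<or> diag k = 1"
    using not_two_0(3)[of i k] not_two_2(3)[of i k] col_range[of i] diag_range[of k]
      col_2D[of i "k - i"] col_0D[of i "k - i"] diag_2D[of i "k - i"] diag_0D[of i "k - i"] by auto
qed

text \<open>If columns and antidiagonals all have value 1, then \<open>e i j\<close> and
  \<open>e (i + 1) j\<close> both complete the same \<open>f\<close> to 1, so \<open>e\<close> is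
  constant along rows. On row 0 it vanishes, \<open>f\<close> is then 1, and so is
  \<open>s\<close>.\<close>

lemma full_row:
  assumes "\<And>i. col i = 1" "\<And>k. diag k = 1"
  shows "s i 0 = 1"
proof -
  have "e (i + 1) j = e i j" for i j
    using diag_eq[of i j] col_eq[of "i + 1" j] assms by simp
  then have "e i 0 = e 0 0" for i by (rule int_shift_invariant)
  then have "e i 0 = 0" "e (i - 1) 0 = 0" using origin_values(1) by simp_all
  then show ?thesis
    using row_eq[of i 0] tile1[of "i - 1" 0] origin_values(3) by (simp add: algebra_simps)
qed

lemma full_col:
  assumes "\<And>j. row j = 1" "\<And>k. diag k = 1"
  shows "s 0 j = 1"
proof -
  have "e i (j + 1) = e i j" for i j
    using diag_eq[of i j] row_eq[of i "j + 1"] assms by simp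
  then have "e 0 j = e 0 0" for j by (rule int_shift_invariant)
  then have "e 0 j = 0" "e 0 (j - 1) = 0" using origin_values(1) by simp_all
  then show ?thesis
    using col_eq[of 0 j] tile2[of 0 "j - 1"] origin_values(4) by (simp add: algebra_simps)
qed

lemma full_diag:
  assumes "\<And>j. row j = 1" "\<And>i. col i = 1"
  shows "s k (-k) = 1"
proof -
  \<comment> \<open>Both cells lie on antidiagonal \<open>-1\<close> and complete
    \<open>f i (-i)\<close> to 1, one through its row and the other through its column.\<close>
  have "e (i + 1 - 1) (- (i + 1)) = e (i - 1) (-i)" for i
    using row_eq[of "i - 1" "-i"] col_eq[of i "-i - 1"] assms by simp
  from int_shift_invariant[of "\<lambda>i. e (i - 1) (-i)", OF this, of _ 0]
  have e0: "e (i - 1) (-i) = 0" for i using origin_values(2) by simp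
  have "e (k - 1) (-k) = 0" "e k (-k - 1) = 0" using e0[of k] e0[of "k + 1"] by simp_all
  then show ?thesis
    using diag_eq[of k "-k - 1"] tile1[of "k - 1" "-k"] origin_values(5) by (simp add: algebra_simps)
qed

text \<open>A single line of value other than 1 forces value 1 throughout the other two directions,
  so at least two directions are constantly 1.\<close>

theorem full_line:
  "(\<forall>i. s i 0 = 1) \<or> (\<forall>j. s 0 j = 1) \<or> (\<forall>k. s k (-k) = 1)"
  using full_row full_col full_diag at_most_one_direction by metis

end

section \<open>Graphs without three independent points\<close>

lemma two_cliques:
  fixes R :: "'a \<Rightarrow> 'a \<Rightarrow> bool" and Z :: "'a set"
  defines "N \<equiv> \<lambda>z. {w \<in> Z. R z w}"
  assumes fin: "finite Z" and card_Z: "card Z = 2 * s" and "0 < s"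
    and refl: "\<And>z. z \<in> Z \<Longrightarrow> R z z"
    and sym: "\<And>z w. R z w \<Longrightarrow> R w z"
    and deg: "\<And>z. z \<in> Z \<Longrightarrow> card (N z) \<le> s"
    and three: "\<And>u v w. u \<in> Z \<Longrightarrow> v \<in> Z \<Longrightarrow> w \<in> Z \<Longrightarrow> R u v \<or> R u w \<or> R v w"
    and z: "z \<in> Z"
  shows "card (N z) = s" and "\<And>u. u \<in> N z \<Longrightarrow> N u = N z"
    and "\<exists>w\<in>Z. Z = N z \<union> N w \<and> N z \<inter> N w = {}"
proof -
  have finN: "finite (N z)" for z using fin by (simp add: N_def)
  have split: "\<exists>w\<in>Z. Z = N z \<union> N w \<and> N z \<inter> N w = {} \<and> card (N z) = s" if z: "z \<in> Z" for z
  proof -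
    have "N z \<noteq> Z" using deg[OF z] card_Z \<open>0 < s\<close> by auto
    \<comment> \<open>Two unrelated points dominate \<open>Z\<close>; as each neighbourhood has at
      most \<open>s\<close> of the \<open>2 * s\<close> points, they are disjoint and of size
      exactly \<open>s\<close>.\<close>
    then obtain w where w: "w \<in> Z" "\<not> R z w" by (auto simp: N_def)
    have Z: "Z = N z \<union> N w" using three z w by (auto simp: N_def)
    then have "card (N z) + card (N w) = 2 * s + card (N z \<inter> N w)"
      using card_Un_Int[OF finN finN, of z w] card_Z by simp
    with deg[OF z] deg[OF w(1)] have "card (N z) = s" "card (N z \<inter> N w) = 0" by auto
    with Z w finN show ?thesis by auto
  qed
  obtain w where w: "w \<in> Z" "Z = N z \<union> N w" "N z \<inter> N w = {}" and card_N: "card (N z) = s"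
    using split[OF z] by (elim bexE conjE)
  show "card (N z) = s" by (fact card_N)
  show "\<exists>w\<in>Z. Z = N z \<union> N w \<and> N z \<inter> N w = {}" by (intro bexI conjI) (fact w)+
  fix u assume u: "u \<in> N z"
  \<comment> \<open>Neither \<open>u\<close> nor \<open>v\<close> is related to \<open>w\<close>, so
    the condition on three points relates them to each other.\<close>
  have "R u v" if "v \<in> N z" for v
    using three[of u v w] u that w(1,3) sym by (auto simp: N_def)
  then have "N z \<subseteq> N u" by (auto simp: N_def)
  moreover have "card (N u) = card (N z)"
    using split[of u] card_N u by (auto simp: N_def)
  ultimately show "N u = N z" using card_subset_eq[OF finN] by metis
qed

section \<open>Halves and doubles in an abelian group\<close>

context comm_group
begin

lemma inv_cancel_left [simp]:
  assumes "x \<in> carrier G" "y \<in> carrier G"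
  shows "inv x \<otimes> (x \<otimes> y) = y" "x \<otimes> (inv x \<otimes> y) = y"
  using assms by (simp_all add: m_assoc[symmetric])

lemma inv_cancel_middle:
  assumes "x \<in> carrier G" "y \<in> carrier G"
  shows "x \<otimes> (y \<otimes> inv x) = y" "inv x \<otimes> (y \<otimes> x) = y"
    and "z \<in> carrier G \<Longrightarrow> x \<otimes> (y \<otimes> (inv x \<otimes> z)) = y \<otimes> z"
    and "z \<in> carrier G \<Longrightarrow> inv x \<otimes> (y \<otimes> (x \<otimes> z)) = y \<otimes> z"
  using assms by (simp_all add: m_lcomm[of _ y])

lemma doubles_subgroup: "subgroup (doubles G) G"
proof
  show "doubles G \<subseteq> carrier G" by (auto simp: doubles_def)
  have "\<one> = \<one> \<otimes> \<one>" by simp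
  then show "\<one> \<in> doubles G" unfolding doubles_def by blast
  fix x assume "x \<in> doubles G"
  then obtain a where a: "a \<in> carrier G" "x = a \<otimes> a" by (auto simp: doubles_def)
  then have "inv x = inv a \<otimes> inv a" by (simp add: inv_mult)
  then show "inv x \<in> doubles G" using a by (auto simp: doubles_def)
  fix y assume "y \<in> doubles G"
  then obtain b where b: "b \<in> carrier G" "y = b \<otimes> b" by (auto simp: doubles_def)
  have "x \<otimes> y = (a \<otimes> b) \<otimes> (a \<otimes> b)" using a b by (simp add: m_ac)
  then show "x \<otimes> y \<in> doubles G" using a b by (auto simp: doubles_def)
qed

text \<open>The halves of \<open>u\<close> are either none or a translate of the 2-torsion.\<close>

lemma card_halves_le:
  assumes "finite (carrier G)"
  shows "card {x \<in> carrier G. x \<otimes> x = u} \<le> L_group G"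
proof (cases "{x \<in> carrier G. x \<otimes> x = u} = {}")
  case False
  then obtain a where a: "a \<in> carrier G" "u = a \<otimes> a" by auto
  have "(x \<otimes> inv a) \<otimes> (x \<otimes> inv a) = (x \<otimes> x) \<otimes> inv (a \<otimes> a)" if "x \<in> carrier G" for x
    using that a by (simp add: m_ac inv_mult)
  then have "(\<lambda>x. x \<otimes> inv a) ` {x \<in> carrier G. x \<otimes> x = u} \<subseteq> {x \<in> carrier G. x \<otimes> x = \<one>}"
    using a by auto
  moreover have "inj_on (\<lambda>x. x \<otimes> inv a) {x \<in> carrier G. x \<otimes> x = u}"
    using a by (auto intro!: inj_onI)
  ultimately show ?thesis
    unfolding L_group_def using assms by (intro card_inj_on_le) auto
next
  case True
  then show ?thesis by (simp only: card.empty)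
qed

lemma L_group_pos: "finite (carrier G) \<Longrightarrow> 0 < L_group G"
  unfolding L_group_def by (subst card_gt_0_iff) auto

end

section \<open>Equality in the counting of representations of a missed element\<close>

locale critical_restricted_sumset = comm_group G for G (structure) +
  fixes A B S :: "'a set"
  assumes finite_carrier: "finite (carrier G)"
    and A_subset: "A \<subseteq> carrier G" and B_subset: "B \<subseteq> carrier G" and S_subset: "S \<subseteq> carrier G"
    and S_nonempty: "S \<noteq> {}"
    and card_A_B: "card A + card B = order G + card S * L_group G"
    and card_missed: "card (carrier G - restricted_sumset G S A B) = 2 * card S"
begin

definition Z :: "'a set" where "Z = carrier G - restricted_sumset G S A B"

lemma Z_carrier: "z \<in> Z \<Longrightarrow> z \<in> carrier G" by (simp add: Z_def)
lemma S_carrier: "t \<in> S \<Longrightarrow> t \<in> carrier G" using S_subset by blast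

lemma missed_extremal:
  assumes z: "z \<in> Z"
  shows "{x \<in> A. z \<otimes> inv x \<in> B} = {x \<in> carrier G. x \<otimes> x \<otimes> inv z \<in> S}"
    and "A \<union> {x \<in> carrier G. z \<otimes> inv x \<in> B} = carrier G"
    and "\<And>t. t \<in> S \<Longrightarrow> t \<otimes> z \<in> doubles G"
proof -
  note [simp] = Z_carrier[OF z]
  define C where "C = {x \<in> carrier G. z \<otimes> inv x \<in> B}"
  define X where "X = {x \<in> carrier G. x \<otimes> x \<otimes> inv z \<in> S}"
  \<comment> \<open>An element \<open>t\<close> with \<open>t + z\<close> not a double contributes
    no point to \<open>X\<close>, so \<open>S'\<close> counts the fibres of size at most
    \<open>L(G)\<close> that can be non-empty.\<close>
  define S' where "S' = {t \<in> S. t \<otimes> z \<in> doubles G}"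
  have finS: "finite S" using S_subset finite_carrier finite_subset by blast
  have finA: "finite A" using A_subset finite_carrier finite_subset by blast
  have finC: "finite C" "finite X" using finite_carrier by (auto simp: C_def X_def)
  have "bij_betw (\<lambda>x. z \<otimes> inv x) C B"
    using B_subset
    by (intro bij_betw_byWitness[where f' = "\<lambda>y. z \<otimes> inv y"]) (auto simp: C_def inv_mult subset_iff)
  then have cardC: "card C = card B" by (rule bij_betw_same_card)
  have AC_X: "A \<inter> C \<subseteq> X"
  proof
    fix x assume x: "x \<in> A \<inter> C"
    then have xc: "x \<in> carrier G" by (simp add: C_def)
    have "x \<otimes> (z \<otimes> inv x) = z" using xc by (simp add: inv_cancel_middle)
    moreover have "z \<notin> restricted_sumset G S A B" using z by (simp add: Z_def)
    ultimately have "x \<otimes> inv (z \<otimes> inv x) \<in> S"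
      using x unfolding restricted_sumset_def C_def by force
    moreover have "x \<otimes> inv (z \<otimes> inv x) = x \<otimes> x \<otimes> inv z" using xc by (simp add: inv_mult m_ac)
    ultimately show "x \<in> X" using xc by (simp add: X_def)
  qed
  have "X \<subseteq> (\<Union>t\<in>S'. {x \<in> carrier G. x \<otimes> x = t \<otimes> z})"
  proof
    fix x assume "x \<in> X"
    then have x: "x \<in> carrier G" "x \<otimes> x \<otimes> inv z \<in> S" by (auto simp: X_def)
    moreover have "x \<otimes> x \<otimes> inv z \<otimes> z = x \<otimes> x" using x by (simp add: m_assoc)
    ultimately show "x \<in> (\<Union>t\<in>S'. {x \<in> carrier G. x \<otimes> x = t \<otimes> z})"
      by (auto simp: S'_def doubles_def intro!: bexI[of _ "x \<otimes> x \<otimes> inv z"])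
  qed
  then have "card X \<le> card (\<Union>t\<in>S'. {x \<in> carrier G. x \<otimes> x = t \<otimes> z})"
    using finite_carrier finS by (intro card_mono) (auto simp: S'_def)
  also have "\<dots> \<le> (\<Sum>t\<in>S'. card {x \<in> carrier G. x \<otimes> x = t \<otimes> z})"
    using finS by (intro card_UN_le) (simp add: S'_def)
  also have "\<dots> \<le> (\<Sum>t\<in>S'. L_group G)"
    by (intro sum_mono card_halves_le finite_carrier)
  finally have cardX: "card X \<le> card S' * L_group G" by simp
  have S'_le: "card S' \<le> card S" using finS by (auto simp: S'_def intro: card_mono)
  then have S'_L: "card S' * L_group G \<le> card S * L_group G" by simp
  have "card A + card C = card (A \<union> C) + card (A \<inter> C)"
    using card_Un_Int[OF finA finC(1)] .
  moreover have AC_sub: "A \<union> C \<subseteq> carrier G" using A_subset by (auto simp: C_def)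
  then have AC: "card (A \<union> C) \<le> order G"
    unfolding order_def by (rule card_mono[OF finite_carrier])
  moreover have cX: "card (A \<inter> C) \<le> card X" using AC_X finC by (intro card_mono) auto
  \<comment> \<open>In \<open>|A| + |C| = |A \<union> C| + |A \<inter> C| \<le> |G| + |X| \<le> |G|
    + |S'| L(G) \<le> |G| + |S| L(G)\<close> the two ends agree, so every inequality is an
    equality.\<close>
  ultimately have eqs: "card (A \<inter> C) = card X" "card S' * L_group G = card S * L_group G"
    "card (A \<union> C) = order G"
    using cardX S'_L cardC card_A_B by linarith+
  have "A \<inter> C = X" using AC_X eqs(1) finC by (intro card_subset_eq) auto
  moreover have "A \<inter> C = {x \<in> A. z \<otimes> inv x \<in> B}" using A_subset by (auto simp: C_def)
  ultimately show "{x \<in> A. z \<otimes> inv x \<in> B} = {x \<in> carrier G. x \<otimes> x \<otimes> inv z \<in> S}"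
    by (simp add: X_def)
  show "A \<union> {x \<in> carrier G. z \<otimes> inv x \<in> B} = carrier G"
    using card_subset_eq[OF finite_carrier AC_sub] eqs(3) by (simp add: order_def C_def)
  have "card S' = card S" using eqs(2) L_group_pos[OF finite_carrier] by simp
  then have "S' = S" using finS by (intro card_subset_eq) (auto simp: S'_def)
  then show "\<And>t. t \<in> S \<Longrightarrow> t \<otimes> z \<in> doubles G" by (auto simp: S'_def)
qed

section \<open>From missed elements to lattice tilings\<close>

definition F :: "'a \<Rightarrow> bool" where "F u \<longleftrightarrow> (\<forall>x\<in>carrier G. x \<otimes> x = u \<longrightarrow> x \<in> A)"
text \<open>The sign makes \<open>E\<close> independent of \<open>z\<close>: if \<open>x\<close> is
  a half of \<open>v + 2z\<close>, then \<open>z - x\<close> is a half of \<open>-v\<close>. One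
  function therefore serves all elements of \<open>Z\<close>.\<close>

definition E :: "'a \<Rightarrow> bool" where "E v \<longleftrightarrow> (\<forall>y\<in>carrier G. y \<otimes> y = inv v \<longrightarrow> y \<notin> B)"

text \<open>All halves \<open>x\<close> of \<open>v + 2z\<close> share
  \<open>2x - z = v + z\<close>. If this lies in \<open>S\<close>, every such \<open>x\<close> is in
  \<open>A\<close> with \<open>z - x\<close> in \<open>B\<close>; otherwise exactly one of
  \<open>x\<close> in \<open>A\<close> and \<open>z - x\<close> in \<open>B\<close> holds.\<close>

lemma tiling:
  assumes z: "z \<in> Z" and v: "v \<in> doubles G"
  shows "of_bool (F (v \<otimes> (z \<otimes> z))) = (of_bool (v \<otimes> z \<in> S) + of_bool (E v) :: int)"
proof -
  note [simp] = Z_carrier[OF z]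
  obtain h where h: "h \<in> carrier G" "v = h \<otimes> h" using v by (auto simp: doubles_def)
  then have [simp]: "v \<in> carrier G" by simp
  note inter = missed_extremal(1)[OF z] and un = missed_extremal(2)[OF z]
  have square: "x \<otimes> x \<otimes> inv z = v \<otimes> z" if "x \<otimes> x = v \<otimes> (z \<otimes> z)" for x
    using that by (simp add: m_assoc)
  have refl: "(z \<otimes> inv x) \<otimes> (z \<otimes> inv x) = (z \<otimes> z) \<otimes> inv (x \<otimes> x)" if "x \<in> carrier G" for x
    using that by (simp add: m_ac inv_mult)
  have twice: "z \<otimes> inv (z \<otimes> inv x) = x" if "x \<in> carrier G" for x
    using that by (simp add: inv_mult)
  \<comment> \<open>As \<open>E\<close> is a universal statement, an actual half is needed to refute
    it: \<open>-h\<close> works, being the mirror image of \<open>h + z\<close>.\<close>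
  have "\<not> E v" if "v \<otimes> z \<in> S"
  proof -
    have "(h \<otimes> z) \<otimes> (h \<otimes> z) = v \<otimes> (z \<otimes> z)" using h by (simp add: m_ac)
    then have "(h \<otimes> z) \<otimes> (h \<otimes> z) \<otimes> inv z \<in> S" using that square by simp
    then have "h \<otimes> z \<in> {x \<in> A. z \<otimes> inv x \<in> B}" using h by (simp add: inter)
    then have "z \<otimes> inv (h \<otimes> z) \<in> B" by simp
    moreover have "z \<otimes> inv (h \<otimes> z) = inv h"
      using h(1) by (simp add: inv_mult inv_cancel_middle)
    moreover have "inv h \<otimes> inv h = inv v" using h by (simp add: inv_mult)
    ultimately show ?thesis using h by (auto simp: E_def)
  qed
  moreover have "F (v \<otimes> (z \<otimes> z))" if "v \<otimes> z \<in> S"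
    unfolding F_def
  proof (intro ballI impI)
    fix x assume x: "x \<in> carrier G" "x \<otimes> x = v \<otimes> (z \<otimes> z)"
    then have "x \<in> {x \<in> A. z \<otimes> inv x \<in> B}" using that square by (simp add: inter)
    then show "x \<in> A" by simp
  qed
  moreover have "F (v \<otimes> (z \<otimes> z))" if "E v"
    unfolding F_def
  proof (intro ballI impI)
    fix x assume x: "x \<in> carrier G" "x \<otimes> x = v \<otimes> (z \<otimes> z)"
    have "(z \<otimes> z) \<otimes> inv (v \<otimes> (z \<otimes> z)) = inv v"
      by (simp add: inv_mult[of v] inv_cancel_middle)
    then have "(z \<otimes> inv x) \<otimes> (z \<otimes> inv x) = inv v"
      by (simp only: refl[OF x(1)] x(2))
    then have "z \<otimes> inv x \<notin> B" using that x by (simp add: E_def)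
    moreover have "x \<in> A \<union> {x \<in> carrier G. z \<otimes> inv x \<in> B}" using x by (simp only: un)
    ultimately show "x \<in> A" by simp
  qed
  moreover have "E v" if "F (v \<otimes> (z \<otimes> z))" "v \<otimes> z \<notin> S"
    unfolding E_def
  proof (intro ballI impI)
    fix y assume y: "y \<in> carrier G" "y \<otimes> y = inv v"
    define x where "x = z \<otimes> inv y"
    have x: "x \<in> carrier G" "z \<otimes> inv x = y" using y twice by (simp_all add: x_def)
    have xx: "x \<otimes> x = v \<otimes> (z \<otimes> z)"
      unfolding x_def refl[OF y(1)] y(2) by (simp add: m_comm)
    then have "x \<in> A" "x \<otimes> x \<otimes> inv z \<notin> S" using that x square by (auto simp: F_def)
    then have "x \<notin> {x \<in> A. z \<otimes> inv x \<in> B}" by (simp add: inter)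
    then show "y \<notin> B" using \<open>x \<in> A\<close> x by simp
  qed
  ultimately show ?thesis by (cases "v \<otimes> z \<in> S"; cases "E v"; cases "F (v \<otimes> (z \<otimes> z))") auto
qed

definition linked :: "'a \<Rightarrow> 'a \<Rightarrow> 'a \<Rightarrow> bool" where
  "linked t z w \<longleftrightarrow> t \<otimes> (z \<otimes> inv w) \<in> S \<and> t \<otimes> (w \<otimes> inv z) \<in> S"

text \<open>In the lattice \<open>t + ix + jy\<close>, a row, column or antidiagonal inside
  \<open>S\<close> contains both neighbours of \<open>t\<close> in that direction: \<open>t\<close>
  plus or minus \<open>z2 - z1\<close>, \<open>z3 - z1\<close> or \<open>z2 - z3\<close>.\<close>

lemma linked_pair_of_three:
  assumes t: "t \<in> S" and Z: "z1 \<in> Z" "z2 \<in> Z" "z3 \<in> Z"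
  shows "linked t z1 z2 \<or> linked t z1 z3 \<or> linked t z2 z3"
proof -
  note [simp] = Z[THEN Z_carrier] S_carrier[OF t]
  define x where "x = z2 \<otimes> inv z1"
  define y where "y = z3 \<otimes> inv z1"
  define pt where "pt i j = t \<otimes> x [^] (i::int) \<otimes> y [^] (j::int)" for i j
  have [simp]: "x \<in> carrier G" "y \<in> carrier G" by (simp_all add: x_def y_def)
  have [simp]: "pt i j \<in> carrier G" for i j by (simp add: pt_def)
  interpret D: subgroup "doubles G" G by (rule doubles_subgroup)
  have diff: "w \<otimes> inv z1 \<in> doubles G" if "w \<in> Z" for w
  proof -
    have "(t \<otimes> w) \<otimes> inv (t \<otimes> z1) \<in> doubles G"
      using missed_extremal(3) that Z t by blast
    moreover have "(t \<otimes> w) \<otimes> inv (t \<otimes> z1) = w \<otimes> inv z1"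
      using Z_carrier[OF that] by (simp add: inv_mult m_ac inv_cancel_middle)
    ultimately show ?thesis by simp
  qed
  \<comment> \<open>\<open>tiling\<close> is applied at \<open>pt i j - z1\<close>, which must be a
    double; subtracting \<open>2 z1\<close> from the double \<open>t + z1\<close> settles the base
    point.\<close>
  have "t \<otimes> inv z1 = (t \<otimes> z1) \<otimes> inv (z1 \<otimes> z1)" by (simp add: inv_mult m_ac)
  moreover have "z1 \<otimes> z1 \<in> doubles G" unfolding doubles_def using Z_carrier[OF Z(1)] by blast
  ultimately have t_z1: "t \<otimes> inv z1 \<in> doubles G" using missed_extremal(3)[OF Z(1) t] by simp
  have pow: "a [^] (i::int) \<in> doubles G" if "a \<in> doubles G" for a i
    by (rule subgroup_int_pow_closed[OF doubles_subgroup that])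
  have pt_D: "pt i j \<otimes> inv z1 \<in> doubles G" for i j
  proof -
    have "(t \<otimes> inv z1) \<otimes> (x [^] i \<otimes> y [^] j) \<in> doubles G"
      using t_z1 pow diff Z by (simp add: x_def y_def)
    moreover have "pt i j \<otimes> inv z1 = (t \<otimes> inv z1) \<otimes> (x [^] i \<otimes> y [^] j)"
      by (simp add: pt_def m_ac)
    ultimately show ?thesis by simp
  qed
  have pt_x: "pt (i + 1) j = pt i j \<otimes> x" for i j
    by (simp add: pt_def int_pow_mult m_ac)
  have pt_y: "pt i (j + 1) = pt i j \<otimes> y" for i j
    by (simp add: pt_def int_pow_mult m_ac)
  define e f s where "e i j = (of_bool (E (pt i j \<otimes> inv z1)) :: int)"
    and "f i j = (of_bool (F (pt i j \<otimes> z1)) :: int)"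
    and "s i j = (of_bool (pt i j \<in> S) :: int)" for i j
  have tile: "of_bool (F (pt i j \<otimes> (w \<otimes> inv z1) \<otimes> (w \<otimes> inv z1) \<otimes> z1)) =
      (of_bool (pt i j \<otimes> (w \<otimes> inv z1) \<in> S) + e i j :: int)" if "w \<in> Z" for i j w
  proof -
    note [simp] = Z_carrier[OF that]
    have "pt i j \<otimes> inv z1 \<otimes> (w \<otimes> w) = pt i j \<otimes> (w \<otimes> inv z1) \<otimes> (w \<otimes> inv z1) \<otimes> z1"
      "pt i j \<otimes> inv z1 \<otimes> w = pt i j \<otimes> (w \<otimes> inv z1)"
      by (simp_all add: m_ac)
    then show ?thesis using tiling[OF that pt_D[of i j]] by (simp only: e_def)
  qed
  interpret lattice_tiling e f s
  proof
    fix i j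
    show "f i j = s i j + e i j"
      using tile[OF Z(1), of i j] by (simp add: f_def s_def del: of_bool_eq_iff)
    have "pt (i + 2) j = pt i j \<otimes> x \<otimes> x"
      using pt_x[of i j] pt_x[of "i + 1" j] by (simp only: add.assoc one_add_one)
    then show "f (i + 2) j = s (i + 1) j + e i j"
      using tile[OF Z(2), of i j, folded x_def] by (simp only: f_def s_def pt_x)
    have "pt i (j + 2) = pt i j \<otimes> y \<otimes> y"
      using pt_y[of i j] pt_y[of i "j + 1"] by (simp only: add.assoc one_add_one)
    then show "f i (j + 2) = s i (j + 1) + e i j"
      using tile[OF Z(3), of i j, folded y_def] by (simp only: f_def s_def pt_y)
    show "s 0 0 = 1" using t by (simp add: s_def pt_def)
  qed (auto simp: e_def f_def s_def)
  have inv_x: "inv x = z1 \<otimes> inv z2" "inv y = z1 \<otimes> inv z3"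
    by (simp_all add: x_def y_def inv_mult m_comm)
  have xy: "x \<otimes> inv y = z2 \<otimes> inv z3" "inv x \<otimes> y = z3 \<otimes> inv z2"
    by (simp_all add: inv_x) (simp_all add: x_def y_def m_ac)
  have m1: "a [^] (-1::int) = inv a" if "a \<in> carrier G" for a
    using that by (simp add: int_pow_neg)
  from full_line show ?thesis
  proof (elim disjE)
    assume "\<forall>i. s i 0 = 1"
    then have "s 1 0 = 1" "s (-1) 0 = 1" by blast+
    then have "linked t z1 z2"
      by (auto simp: s_def pt_def m1 linked_def inv_x) (simp add: x_def)
    then show ?thesis by blast
  next
    assume "\<forall>j. s 0 j = 1"
    then have "s 0 1 = 1" "s 0 (-1) = 1" by blast+
    then have "linked t z1 z3"
      by (auto simp: s_def pt_def m1 linked_def inv_x) (simp add: y_def)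
    then show ?thesis by blast
  next
    assume "\<forall>k. s k (-k) = 1"
    then have "s 1 (-1) = 1" "s (-1) (-(-1)) = 1" by blast+
    then have "t \<otimes> (x \<otimes> inv y) \<in> S" "t \<otimes> (inv x \<otimes> y) \<in> S"
      by (auto simp: s_def pt_def m1 m_assoc)
    then show ?thesis by (simp add: xy linked_def)
  qed
qed

section \<open>Cliques as cosets\<close>

theorem coset_structure:
  "\<exists>H. subgroup H (G\<lparr>carrier := doubles G\<rparr>) \<and> S \<in> rcosets H \<and>
     (\<exists>C\<in>rcosets H. \<exists>D\<in>rcosets H. C \<noteq> D \<and> Z = C \<union> D)"
proof -
  obtain t where t: "t \<in> S" using S_nonempty by blast
  note [simp] = S_carrier[OF t]
  have finS: "finite S" using S_subset finite_carrier finite_subset by blast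
  have finZ: "finite Z" using finite_carrier by (simp add: Z_def)
  have posS: "0 < card S" using finS S_nonempty by (simp add: card_gt_0_iff)
  have cardZ: "card Z = 2 * card S" using card_missed by (simp add: Z_def)
  define N where "N z = {w \<in> Z. linked t z w}" for z
  have N_image: "inj_on (\<lambda>w. t \<otimes> (w \<otimes> inv z)) (N z)" "(\<lambda>w. t \<otimes> (w \<otimes> inv z)) ` N z \<subseteq> S"
    if "z \<in> Z" for z
    using Z_carrier[OF that] by (auto simp: N_def linked_def Z_carrier intro!: inj_onI)
  have deg: "card (N z) \<le> card S" if "z \<in> Z" for z
    using card_inj_on_le[OF N_image[OF that] finS] .
  have refl: "linked t z z" if "z \<in> Z" for z using t Z_carrier[OF that] by (simp add: linked_def)
  have sym: "linked t w z" if "linked t z w" for z w using that by (auto simp: linked_def)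
  note three = linked_pair_of_three[OF t]
  note cliques' = two_cliques[where R = "linked t" and Z = Z and s = "card S", folded N_def]
  have card_N: "card (N z) = card S" if "z \<in> Z" for z
    by (rule cliques'(1)) (fact finZ cardZ posS refl sym deg three that)+
  have N_cong: "N u = N z" if "z \<in> Z" "u \<in> N z" for z u
    by (rule cliques'(2)[where z = z]) (fact finZ cardZ posS refl sym deg three that)+
  have N_split: "\<exists>w\<in>Z. Z = N z \<union> N w \<and> N z \<inter> N w = {}" if "z \<in> Z" for z
    by (rule cliques'(3)) (fact finZ cardZ posS refl sym deg three that)+
  define H where "H = S #> inv t"
  have H_carrier: "h \<in> carrier G" if "h \<in> H" for h
    using that S_carrier by (auto simp: H_def r_coset_def)
  have H_sub: "H \<subseteq> carrier G" using H_carrier by blast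
  have S_eq: "S = H #> t"
    using S_subset by (simp add: H_def coset_mult_assoc)
  \<comment> \<open>The map \<open>w \<mapsto> t + w - z\<close> embeds \<open>N z\<close> into
    \<open>S\<close>; equal cardinalities make it onto, and solving for \<open>w\<close> gives
    \<open>H + z\<close>.\<close>
  have N_eq: "N z = H #> z" if z: "z \<in> Z" for z
  proof -
    note [simp] = Z_carrier[OF z]
    have "card ((\<lambda>w. t \<otimes> (w \<otimes> inv z)) ` N z) = card S"
      using card_N[OF z] card_image[OF N_image(1)[OF z]] by metis
    then have img: "(\<lambda>w. t \<otimes> (w \<otimes> inv z)) ` N z = S"
      using card_subset_eq[OF finS N_image(2)[OF z]] by blast
    have "H #> z = (\<lambda>u. u \<otimes> inv t \<otimes> z) ` S"
      unfolding H_def r_coset_def by auto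
    also have "\<dots> = (\<lambda>w. t \<otimes> (w \<otimes> inv z) \<otimes> inv t \<otimes> z) ` N z"
      unfolding img[symmetric] image_image ..
    also have "\<dots> = (\<lambda>w. w) ` N z"
      by (rule image_cong) (auto simp: N_def m_ac dest!: Z_carrier)
    finally show ?thesis by simp
  qed
  obtain z where z: "z \<in> Z" using cardZ posS by fastforce
  note [simp] = Z_carrier[OF z]
  have one_H: "\<one> \<in> H"
    using t unfolding H_def r_coset_def by force
  have H_mult: "H #> h = H" if h: "h \<in> H" for h
  proof -
    \<comment> \<open>Points of one clique have the same neighbourhood, so
      \<open>H + h + z = H + z\<close>, and \<open>z\<close> cancels. Closure and inverses of
      \<open>H\<close> both come from \<open>H + h = H\<close>.\<close>
    have "h \<otimes> z \<in> N z" using h by (auto simp: N_eq[OF z] r_coset_def)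
    then have "H #> (h \<otimes> z) = H #> z"
      using N_cong[OF z] N_eq z by (metis (no_types, lifting) N_def mem_Collect_eq)
    then have "(H #> h #> z) #> inv z = (H #> z) #> inv z"
      using H_sub H_carrier[OF h] by (simp add: coset_mult_assoc)
    then show ?thesis using H_sub H_carrier[OF h]
      by (simp add: coset_mult_assoc r_coset_subset_G m_assoc)
  qed
  have H: "subgroup H G"
  proof
    show "H \<subseteq> carrier G" "\<one> \<in> H" by fact+
    fix h assume h: "h \<in> H"
    show "g \<otimes> h \<in> H" if "g \<in> H" for g
      using H_mult[OF h] that by (auto simp: r_coset_def)
    have "\<one> \<in> H #> h" using H_mult[OF h] one_H by simp
    then obtain g where g: "g \<in> H" "\<one> = g \<otimes> h" by (auto simp: r_coset_def)
    then show "inv h \<in> H" using inv_equality[OF g(2)[symmetric]] H_carrier h by simp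
  qed
  interpret D: subgroup "doubles G" G by (rule doubles_subgroup)
  have "H \<subseteq> doubles G"
  proof
    fix h assume "h \<in> H"
    then obtain u where u: "u \<in> S" "h = u \<otimes> inv t" by (auto simp: H_def r_coset_def)
    have "(u \<otimes> z) \<otimes> inv (t \<otimes> z) \<in> doubles G"
      using missed_extremal(3)[OF z] u t by blast
    moreover have "(u \<otimes> z) \<otimes> inv (t \<otimes> z) = h"
      using u S_carrier[OF u(1)] by (simp add: inv_mult m_ac inv_cancel_middle)
    ultimately show "h \<in> doubles G" by simp
  qed
  then have HD: "subgroup H (G\<lparr>carrier := doubles G\<rparr>)"
    using subgroup_incl[OF H doubles_subgroup] by blast
  obtain w where w: "w \<in> Z" "Z = N z \<union> N w" "N z \<inter> N w = {}" using N_split[OF z] by blast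
  have "z \<in> N z" using z refl by (simp add: N_def)
  then have "N z \<noteq> N w" using w(3) by blast
  moreover have "N u \<in> rcosets H" if "u \<in> Z" for u
    using rcosetsI[OF H_sub Z_carrier[OF that]] N_eq[OF that] by simp
  moreover have "S \<in> rcosets H"
    by (subst S_eq) (rule rcosetsI[OF H_sub S_carrier[OF t]])
  ultimately show ?thesis using HD z w(1,2) by blast
qed

end

theorem theorem16:
  fixes G :: "('a, 'b) monoid_scheme" and A B S :: "'a set"
  assumes "comm_group G" and "finite (carrier G)"
    and "A \<subseteq> carrier G" and "B \<subseteq> carrier G" and "S \<subseteq> carrier G"
    and "A \<noteq> {}" and "B \<noteq> {}" and "S \<noteq> {}"
    and "card A + card B = order G + L_max G S"
    and "L_max G S = card S * L_group G"
    and "int (card (restricted_sumset G S A B)) = int (order G) - 2 * int (card S)"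
  shows "\<exists>H. subgroup H (G\<lparr>carrier := doubles G\<rparr>) \<and>
           S \<in> rcosets\<^bsub>G\<^esub> H \<and>
           (\<exists>C \<in> rcosets\<^bsub>G\<^esub> H. \<exists>D \<in> rcosets\<^bsub>G\<^esub> H. C \<noteq> D \<and>
              carrier G - restricted_sumset G S A B = C \<union> D)"
proof -
  interpret comm_group G by fact
  have "restricted_sumset G S A B \<subseteq> carrier G"
    using assms(3,4) by (auto simp: restricted_sumset_def)
  then have "card (carrier G - restricted_sumset G S A B) =
      order G - card (restricted_sumset G S A B)"
    unfolding order_def using assms(2) by (meson card_Diff_subset finite_subset)
  then have "card (carrier G - restricted_sumset G S A B) = 2 * card S"
    using assms(11) by linarith
  \<comment> \<open>Substituting the value of \<open>L_max\<close> turns the hypothesis on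
    \<open>|A| + |B|\<close> into the form used in the count.\<close>
  then interpret critical_restricted_sumset G A B S
    using assms(2-5,8-10) by unfold_locales auto
  show ?thesis using coset_structure by (simp only: Z_def)
qed

end
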